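(* Let $G$ be a tree, let $\bowtie$ be a non-trivial balanced equivalence relation on $V(G)$, and let $G=G^0,G^1,\ldots,G^s$ be the sequence of trees obtained by the pruning process. Then for each $c\in V(G)$ there exists an index $i\in\{0,\ldots,s\}$ such that all vertices of the class $[c]_{\bowtie}$ are leaves of $G^i$.
   Context: Graphs are finite and simple (undirected, no multiple edges, no loops). A tree is a connected graph without cycles. A leaf of a tree is a vertex of degree one; in addition, the single vertex of a one-vertex tree is regarded as a leaf of that tree. An equivalence relation $\bowtie$ on $V(G)$ is balanced if, whenever $c\bowtie d$, there is a bijection $\beta$ from the set of neighbors of $c$ to the set of neighbors of $d$ with $v\bowtie\beta(v)$ for every neighbor $v$ of $c$. It is trivial if every class is a singleton, and non-trivial otherwise; $[c]_{\bowtie}$ is the $\bowtie$-class of $c$. Pruning process: $G^0=G$, and $G^i=G^{i-1}\setminus L^{i-1}$, where $L^{i-1}$ is the set of leaves of $G^{i-1}$ and $G^{i-1}\setminus L^{i-1}$ is obtained by removing the vertices of $L^{i-1}$ together with all their incident edges. The process stops at the first step $s$ for which $G^s$ is either the 2-vertex tree (one edge) or the 1-vertex graph (no edge). *)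

theory Defs
  imports "Graph_Theory.Graph_Theory"
begin

text \<open>
  Finite simple graphs are the library's \<open>graph\<close>s: finite loop-free symmetric digraphs without
  parallel arcs, an undirected edge being a pair of opposite arcs. The library's \<open>tree\<close> cannot be
  used for them, because its \<open>forest\<close> also forbids the closed walk \<open>u, v, u\<close> along a single edge,
  which is not a cycle of the undirected graph. The cycles of the undirected graph are the library
  cycles of length at least three. Connectedness includes having at least one vertex.
\<close>

definition undirected_tree :: "('a, 'b) pre_digraph \<Rightarrow> bool" where
  "undirected_tree G \<longleftrightarrow>
     graph G \<and> connected G \<and> \<not> (\<exists>p. pre_digraph.cycle G p \<and> 3 \<le> length p)"

definition neighbors :: "('a, 'b) pre_digraph \<Rightarrow> 'a \<Rightarrow> 'a set" where
  "neighbors G c = {v. c \<rightarrow>\<^bsub>G\<^esub> v}"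

text \<open>Every edge at \<open>v\<close> contributes exactly one outgoing arc, so the degree is the out-degree.\<close>

definition leaves :: "('a, 'b) pre_digraph \<Rightarrow> 'a set" where
  "leaves G = {v \<in> verts G. out_degree G v = 1 \<or> verts G = {v}}"

definition balanced :: "('a, 'b) pre_digraph \<Rightarrow> 'a rel \<Rightarrow> bool" where
  "balanced G R \<longleftrightarrow>
     (\<forall>c d. (c, d) \<in> R \<longrightarrow>
       (\<exists>\<beta>. bij_betw \<beta> (neighbors G c) (neighbors G d) \<and> (\<forall>v \<in> neighbors G c. (v, \<beta> v) \<in> R)))"

definition trivial_equiv :: "'a set \<Rightarrow> 'a rel \<Rightarrow> bool" where
  "trivial_equiv V R \<longleftrightarrow> (\<forall>C \<in> V // R. is_singleton C)"

definition prune :: "('a, 'b) pre_digraph \<Rightarrow> ('a, 'b) pre_digraph" where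
  "prune G = G \<restriction> (verts G - leaves G)"

definition pruned :: "('a, 'b) pre_digraph \<Rightarrow> nat \<Rightarrow> ('a, 'b) pre_digraph" where
  "pruned G i = (prune ^^ i) G"

definition pruning_final :: "('a, 'b) pre_digraph \<Rightarrow> bool" where
  "pruning_final H \<longleftrightarrow>
     (undirected_tree H \<and> card (verts H) = 2) \<or> (card (verts H) = 1 \<and> arcs H = {})"

text \<open>For a tree some \<open>pruned G s\<close> is final, so the least such \<open>s\<close> exists.\<close>

definition pruning_length :: "('a, 'b) pre_digraph \<Rightarrow> nat" where
  "pruning_length G = (LEAST s. pruning_final (pruned G s))"

end

theory Submission
  imports Defs
begin

text \<open>
  Pruning is invariant under the relation: if the vertex set of a pruned graph is a union of
  classes, the balancing bijections restrict to it, so related vertices have equal degree there and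
  its leaves form again a union of classes. Hence the vertices of a class disappear simultaneously.
  The process does end in a one- or two-vertex tree, all of whose vertices are leaves, because
  pruning a tree with at least three vertices yields a smaller tree.
\<close>

section \<open>Degrees, neighbourhoods and induced subgraphs\<close>

lemma (in nomulti_digraph) out_degree_eq_card_neighbors:
  "out_degree G v = card (neighbors G v)"
proof -
  have "neighbors G v = head G ` out_arcs G v"
    by (auto simp: neighbors_def arcs_ends_conv)
  moreover have "inj_on (head G) (out_arcs G v)"
    by (auto simp: inj_on_def arc_to_ends_def intro: no_multi_arcs)
  ultimately show ?thesis
    by (simp add: out_degree_def card_image)
qed

lemma (in wf_digraph) neighbors_subset_verts: "neighbors G v \<subseteq> verts G"
  by (auto simp: neighbors_def adj_in_verts)

lemma (in fin_digraph) finite_neighbors: "finite (neighbors G v)"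
  using neighbors_subset_verts finite_verts by (rule finite_subset)

lemma neighbors_induce_subgraph:
  "neighbors (G \<restriction> S) v = (if v \<in> S then neighbors G v \<inter> S else {})"
  by (auto simp: neighbors_def arcs_ends_conv)

lemma (in graph) graph_induce_subgraph:
  assumes "S \<subseteq> verts G"
  shows "graph (G \<restriction> S)"
proof -
  have ind: "induced_subgraph (G \<restriction> S) G" using assms by auto
  show ?thesis
    using digraphI_induced[OF ind] induced_graph_imp_symmetric[OF sym_arcs ind]
    by (rule digraph.graphI)
qed

lemma (in graph) graph_prune: "graph (prune G)"
  unfolding prune_def by (rule graph_induce_subgraph) auto

lemma verts_prune [simp]: "verts (prune G) = verts G - leaves G"
  by (simp add: prune_def)

lemma pruned_0 [simp]: "pruned G 0 = G"
  by (simp add: pruned_def)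

lemma pruned_Suc: "pruned G (Suc n) = prune (pruned G n)"
  by (simp add: pruned_def)

text \<open>\<open>pruned_Suc\<close> splits off the last pruning step; splitting off the first one
  is what an induction on the size of the tree requires.\<close>

lemma pruned_prune: "pruned (prune G) n = pruned G (Suc n)"
  by (simp add: pruned_def funpow_swap1)

lemma leaves_subset_verts: "leaves G \<subseteq> verts G"
  by (auto simp: leaves_def)

section \<open>Pruning and balanced relations\<close>

text \<open>The balancing bijection preserves degrees; if instead \<open>c\<close> is the only
  vertex, closure forces \<open>d = c\<close>. Closure of the vertex set replaces
  \<open>equiv\<close> because \<open>G\<close> may be a pruned graph, while \<open>R\<close> lives
  on the vertices of the original one.\<close>

lemma (in graph) leaves_related:
  assumes "balanced G R" "R `` verts G \<subseteq> verts G" "c \<in> leaves G" "(c, d) \<in> R"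
  shows "d \<in> leaves G"
proof -
  have d: "d \<in> verts G"
    using assms(2,4) subsetD[OF leaves_subset_verts assms(3)] by blast
  obtain \<beta> where "bij_betw \<beta> (neighbors G c) (neighbors G d)"
    using assms(1,4) unfolding balanced_def by blast
  then have "out_degree G c = out_degree G d"
    by (simp add: out_degree_eq_card_neighbors bij_betw_same_card)
  with d assms(3) show ?thesis
    by (auto simp: leaves_def)
qed

text \<open>A union of classes contains \<open>v\<close> iff it contains \<open>\<beta> v\<close>,
  so the old bijection restricts. For related vertices outside \<open>S\<close> both neighbourhoods
  become empty.\<close>

lemma balanced_induce_subgraph:
  assumes "balanced G R" "sym R" "R `` S \<subseteq> S"
  shows "balanced (G \<restriction> S) R"
  unfolding balanced_def
proof (intro allI impI)
  fix c d assume cd: "(c, d) \<in> R"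
  have closed: "x \<in> S \<longleftrightarrow> y \<in> S" if "(x, y) \<in> R" for x y
    using that assms(2,3) by (blast dest: symD)
  obtain \<beta> where bij: "bij_betw \<beta> (neighbors G c) (neighbors G d)"
    and rel: "\<forall>v \<in> neighbors G c. (v, \<beta> v) \<in> R"
    using assms(1) cd unfolding balanced_def by blast
  have "\<beta> v \<in> S \<longleftrightarrow> v \<in> S" if "v \<in> neighbors G c" for v
    using closed[of v "\<beta> v"] rel that by simp
  moreover have "neighbors G d = \<beta> ` neighbors G c"
    using bij by (simp add: bij_betw_def)
  ultimately have "\<beta> ` (neighbors G c \<inter> S) = neighbors G d \<inter> S"
    by auto
  then have "bij_betw \<beta> (neighbors G c \<inter> S) (neighbors G d \<inter> S)"
    using bij by (auto simp: bij_betw_def intro: inj_on_subset)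
  with rel closed[OF cd] show "\<exists>\<beta>. bij_betw \<beta> (neighbors (G \<restriction> S) c) (neighbors (G \<restriction> S) d) \<and>
      (\<forall>v \<in> neighbors (G \<restriction> S) c. (v, \<beta> v) \<in> R)"
    by (intro exI[of _ \<beta>]) (auto simp: neighbors_induce_subgraph bij_betw_def)
qed

text \<open>The claims support each other in the induction: balancedness makes the leaves, hence
  also the remaining vertices, a union of classes, and this closure keeps the relation balanced
  after the next pruning.\<close>

lemma pruned_invariant:
  assumes "graph G" "equiv (verts G) R" "balanced G R"
  shows "graph (pruned G n) \<and> balanced (pruned G n) R
    \<and> R `` verts (pruned G n) \<subseteq> verts (pruned G n)"
proof (induction n)
  case 0
  have "R `` verts G \<subseteq> verts G"
    using equiv_type[OF assms(2)] by blast
  with assms show ?case by simp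
next
  case (Suc n)
  let ?H = "pruned G n"
  have IH: "graph ?H" "balanced ?H R" "R `` verts ?H \<subseteq> verts ?H"
    using Suc.IH by simp_all
  interpret H: graph ?H by (rule IH)
  have sym: "sym R" using assms(2) by (rule equivE)
  have closed: "R `` (verts ?H - leaves ?H) \<subseteq> verts ?H - leaves ?H"
  proof
    fix d assume "d \<in> R `` (verts ?H - leaves ?H)"
    then obtain c where c: "c \<in> verts ?H" "c \<notin> leaves ?H" "(c, d) \<in> R" by auto
    \<comment> \<open>By symmetry of \<open>R\<close>, a leaf \<open>d\<close> would make
      \<open>c\<close> a leaf.\<close>
    have "d \<notin> leaves ?H"
      using H.leaves_related[OF IH(2,3) _ symD[OF sym c(3)]] c(2) by blast
    moreover have "d \<in> verts ?H" using c(1,3) IH(3) by blast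
    ultimately show "d \<in> verts ?H - leaves ?H" by simp
  qed
  have "balanced (prune ?H) R"
    unfolding prune_def using IH(2) sym closed by (rule balanced_induce_subgraph)
  moreover have "R `` verts (prune ?H) \<subseteq> verts (prune ?H)"
    using closed by simp
  ultimately show ?case
    unfolding pruned_Suc by (intro conjI H.graph_prune)
qed

text \<open>Only leaves are removed, so the step at which a vertex disappears supplies the
  index.\<close>

lemma pruned_verts_or_leaf:
  assumes "c \<in> verts G"
  shows "c \<in> verts (pruned G n) \<or> (\<exists>i<n. c \<in> leaves (pruned G i))"
proof (induction n)
  case 0
  show ?case using assms by simp
next
  case (Suc n)
  then show ?case by (auto simp: pruned_Suc less_Suc_eq)
qed

section \<open>Pruning trees\<close>

text \<open>An end of a longest path has a second neighbour on the path, which closes a cycle.\<close>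

lemma (in graph) cycle_of_min_degree:
  assumes "verts G \<noteq> {}" and deg: "\<And>v. v \<in> verts G \<Longrightarrow> 2 \<le> out_degree G v"
  shows "\<exists>p. cycle p \<and> 3 \<le> length p"
proof -
  let ?P = "\<lambda>(u, p, v). apath u p v"
  obtain x where "x \<in> verts G" using assms(1) by blast
  then have "?P (x, [], x)" by (simp add: apath_Nil_iff)
  \<comment> \<open>The vertices of a path are distinct, which bounds its length by the number of
    vertices, so a longest path exists.\<close>
  then have "\<exists>t. ?P t \<and> (\<forall>s. ?P s \<longrightarrow> length (fst (snd s)) \<le> length (fst (snd t)))"
    by (rule ex_has_greatest_nat[where b = "card (verts G)"]) (auto dest: length_apath_less)
  then obtain u p v where path: "apath u p v"
    and longest: "\<And>u' p' v'. apath u' p' v' \<Longrightarrow> length p' \<le> length p"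
    by fastforce
  have u: "u \<in> verts G" using path by (auto simp: apath_def awalk_def)
  \<comment> \<open>Degree at least two gives \<open>u\<close> a neighbour other than its successor
    on the path. For the empty path \<open>u\<close> is a placeholder that keeps the set a
    singleton.\<close>
  have "\<not> neighbors G u \<subseteq> {if p = [] then u else head G (hd p)}"
  proof
    assume "neighbors G u \<subseteq> {if p = [] then u else head G (hd p)}"
    then have "card (neighbors G u) \<le> 1"
      using card_mono[of "{if p = [] then u else head G (hd p)}"] by simp
    with deg[OF u] show False by (simp add: out_degree_eq_card_neighbors)
  qed
  then obtain w where w: "u \<rightarrow> w" "p \<noteq> [] \<longrightarrow> w \<noteq> head G (hd p)"
    by (auto simp: neighbors_def split: if_splits)
  have uw: "u \<noteq> w" using w(1) adj_not_same by blast
  obtain e where e: "e \<in> arcs G" "tail G e = w" "head G e = u"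
    using graph_symmetric[OF w(1)] by (rule reachableE)
  \<comment> \<open>Prepending \<open>e\<close> cannot give a longer path, so \<open>w\<close>
    already lies on \<open>p\<close>; the segment of \<open>p\<close> from \<open>u\<close> to
    \<open>w\<close> then closes up with \<open>e\<close>.\<close>
  have "\<not> apath w (e # p) v" using longest[of w "e # p" v] by auto
  with path e have "w \<in> set (awalk_verts u p)" by (auto simp: apath_Cons_iff)
  then obtain q r where qr: "p = q @ r" "awalk u q w"
    using awalk_decomp path by (blast dest: awalkI_apath)
  then have "apath u q w"
    using path by (auto simp: apath_append_iff)
  then have "cycle (e # q)"
    using e by (auto simp: cycle_def apath_def awalk_Cons_iff intro!: exI[of _ w])
  \<comment> \<open>An empty \<open>q\<close> would mean \<open>u = w\<close>, and a single arc
    would make \<open>w\<close> the successor of \<open>u\<close> on \<open>p\<close>; both are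
    excluded by the choice of \<open>w\<close>.\<close>
  moreover have "2 \<le> length q"
  proof (cases q)
    case Nil
    then show ?thesis using qr uw by (auto simp: awalk_Nil_iff)
  next
    case (Cons a q')
    then show ?thesis using qr w(2) by (cases q') (auto simp: awalk_simps)
  qed
  ultimately show ?thesis by (intro exI[of _ "e # q"]) auto
qed

section \<open>Leaves of a tree and the tree left after pruning\<close>

text \<open>A locale form of \<open>undirected_tree\<close>. The length bound still admits the
  closed walks along an edge and back.\<close>

locale finite_tree = graph G for G :: "('a, 'b) pre_digraph" (structure) +
  assumes conn: "connected G"
    and acyclic: "cycle p \<Longrightarrow> length p < 3"

lemma undirected_tree_iff_finite_tree: "undirected_tree G \<longleftrightarrow> finite_tree G"
  by (auto simp: undirected_tree_def finite_tree_def finite_tree_axioms_def not_le)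

context finite_tree
begin

lemma reachable_verts:
  assumes "u \<in> verts G" "v \<in> verts G"
  shows "u \<rightarrow>\<^sup>* v"
  using symmetric_connected_imp_strongly_connected[OF sym_arcs conn] assms by blast

lemma verts_nonempty: "verts G \<noteq> {}"
  using symmetric_connected_imp_strongly_connected[OF sym_arcs conn]
  by (simp add: strongly_connected_def)

text \<open>A walk to a second vertex has to leave \<open>v\<close> along some arc.\<close>

lemma neighbors_nonempty:
  assumes "v \<in> verts G" "2 \<le> card (verts G)"
  shows "neighbors G v \<noteq> {}"
proof -
  have "\<not> verts G \<subseteq> {v}" using assms(2) card_mono[of "{v}" "verts G"] by auto
  then obtain w where "w \<in> verts G" "w \<noteq> v" by blast
  with reachable_verts[OF assms(1), of w] show ?thesis
    by (auto simp: neighbors_def elim: converse_reachable_cases)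
qed

lemma leaf_iff:
  assumes "2 \<le> card (verts G)"
  shows "v \<in> leaves G \<longleftrightarrow> (v \<in> verts G \<and> (\<exists>w. neighbors G v = {w}))"
proof -
  have "verts G \<noteq> {v}" using assms by auto
  then show ?thesis
    by (simp add: leaves_def out_degree_eq_card_neighbors card_1_singleton_iff)
qed

lemma neighbors_leaf:
  assumes "2 \<le> card (verts G)" "v \<in> leaves G" "v \<rightarrow>\<^bsub>G\<^esub> w"
  shows "neighbors G v = {w}"
proof -
  have "w \<in> neighbors G v" using assms(3) by (simp add: neighbors_def)
  with assms(2) leaf_iff[OF assms(1)] show ?thesis by auto
qed

text \<open>Without leaves every degree would be at least two, which forces a cycle.\<close>

lemma leaf_exists:
  assumes "2 \<le> card (verts G)"
  shows "leaves G \<noteq> {}"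
proof
  assume none: "leaves G = {}"
  have "2 \<le> out_degree G v" if "v \<in> verts G" for v
  proof -
    have "card (neighbors G v) \<noteq> 0"
      using neighbors_nonempty[OF that assms] finite_neighbors by simp
    moreover have "out_degree G v \<noteq> 1" using none that by (auto simp: leaves_def)
    ultimately show ?thesis by (simp add: out_degree_eq_card_neighbors)
  qed
  then obtain p where "cycle p" "3 \<le> length p"
    using cycle_of_min_degree verts_nonempty by blast
  with acyclic show False by fastforce
qed

text \<open>Two adjacent leaves have no other neighbours, so by connectedness they would be the
  whole tree.\<close>

lemma neighbor_of_leaf_not_leaf:
  assumes "3 \<le> card (verts G)" "v \<in> leaves G" "v \<rightarrow>\<^bsub>G\<^esub> w"
  shows "w \<notin> leaves G"
proof
  assume w: "w \<in> leaves G"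
  have card: "2 \<le> card (verts G)" using assms(1) by simp
  have nv: "neighbors G v = {w}" and nw: "neighbors G w = {v}"
    using neighbors_leaf[OF card assms(2,3)]
      neighbors_leaf[OF card w graph_symmetric[OF assms(3)]] by this
  have "x \<in> {v, w}" if "v \<rightarrow>\<^sup>* x" for x
    using that
  proof (induction rule: reachable_induct)
    case (step x y)
    then show ?case using nv nw by (auto simp: neighbors_def)
  qed simp
  then have "verts G \<subseteq> {v, w}"
    using reachable_verts adj_in_verts[OF assms(3)] by blast
  then have "card (verts G) \<le> card {v, w}"
    by (rule card_mono[rotated]) simp
  also have "\<dots> \<le> 2" by (simp add: card_insert_if)
  finally show False using assms(1) by simp
qed

text \<open>
  Moving every leaf to its neighbour turns each arc into an arc of the pruned graph or into a
  single vertex, which yields walks in the pruned graph.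
\<close>

lemma finite_tree_prune:
  assumes "3 \<le> card (verts G)"
  shows "finite_tree (prune G)"
proof -
  interpret P: graph "prune G" by (rule graph_prune)
  define f where "f v = (if v \<in> leaves G then the_elem (neighbors G v) else v)" for v
  have f_leaf: "f v = w" if "v \<in> leaves G" "v \<rightarrow>\<^bsub>G\<^esub> w" for v w
  proof -
    have "neighbors G v = {w}"
      using that assms by (intro neighbors_leaf) simp_all
    with that show ?thesis by (simp add: f_def)
  qed
  have f_verts: "f v \<in> verts (prune G)" if "v \<in> verts G" for v
  proof (cases "v \<in> leaves G")
    case True
    have "neighbors G v \<noteq> {}" using neighbors_nonempty[OF that] assms by simp
    then obtain w where "v \<rightarrow>\<^bsub>G\<^esub> w" by (auto simp: neighbors_def)
    with True show ?thesis
      using f_leaf neighbor_of_leaf_not_leaf assms adj_in_verts by auto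
  qed (use that in \<open>simp add: f_def\<close>)
  have f_adj: "f u \<rightarrow>\<^sup>*\<^bsub>prune G\<^esub> f v" if adj: "u \<rightarrow> v" for u v
  proof -
    have uv: "u \<in> verts G" "v \<in> verts G" using adj adj_in_verts by auto
    \<comment> \<open>Two adjacent leaves cannot occur here. If exactly one end is a leaf,
      \<open>f\<close> collapses the arc to its other end; otherwise the arc survives
      pruning.\<close>
    consider "u \<in> leaves G" "v \<notin> leaves G" | "u \<notin> leaves G" "v \<in> leaves G"
      | "u \<notin> leaves G" "v \<notin> leaves G"
      using neighbor_of_leaf_not_leaf[OF assms _ adj] by blast
    then show ?thesis
    proof cases
      case 1
      then have "f u = f v" using f_leaf[OF _ adj] by (simp add: f_def)
      with f_verts uv show ?thesis by simp
    next
      case 2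
      then have "f u = f v" using f_leaf[OF _ graph_symmetric[OF adj]] by (simp add: f_def)
      with f_verts uv show ?thesis by simp
    next
      case 3
      then have "v \<in> neighbors (prune G) u"
        using adj uv by (simp add: prune_def neighbors_induce_subgraph) (simp add: neighbors_def)
      with 3 show ?thesis by (simp add: f_def neighbors_def)
    qed
  qed
  have "f u \<rightarrow>\<^sup>*\<^bsub>prune G\<^esub> f v" if "u \<rightarrow>\<^sup>* v" for u v
    using that
  proof (induction rule: reachable_induct)
    case base
    then show ?case using f_verts by simp
  next
    case (step x y)
    then show ?case using f_adj P.reachable_trans by blast
  qed
  then have f_reach: "f u \<rightarrow>\<^sup>*\<^bsub>prune G\<^esub> f v" if "u \<in> verts G" "v \<in> verts G" for u v
    using reachable_verts[OF that] .
  \<comment> \<open>\<open>f\<close> fixes the vertices that survive pruning.\<close>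
  have reach: "u \<rightarrow>\<^sup>*\<^bsub>prune G\<^esub> v"
    if "u \<in> verts (prune G)" "v \<in> verts (prune G)" for u v
    using that f_reach[of u v] by (simp add: f_def)
  have "connected (prune G)"
  proof (rule P.connectedI)
    show "verts (prune G) \<noteq> {}" using verts_nonempty f_verts by blast
  qed (rule P.reachable_mk_symmetricI[OF reach])
  moreover have "subgraph (prune G) G"
    unfolding prune_def by (rule subgraph_induce_subgraphI) auto
  \<comment> \<open>Acyclicity is inherited, since a cycle of a subgraph is a cycle of
    \<open>G\<close>.\<close>
  ultimately show ?thesis
    using subgraph_cycle acyclic by unfold_locales auto
qed

end

section \<open>Termination of the pruning process and its final graph\<close>

text \<open>Induction on the number of vertices: a tree with at least three vertices has a leaf, so
  pruning it gives a strictly smaller tree.\<close>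

lemma pruning_terminates:
  assumes "finite_tree G"
  shows "\<exists>s. pruning_final (pruned G s)"
  using assms
proof (induction "card (verts G)" arbitrary: G rule: less_induct)
  case less
  interpret finite_tree G by (rule less.prems)
  have "card (verts G) \<noteq> 0" using verts_nonempty by simp
  then consider "card (verts G) = 1" | "card (verts G) = 2" | "3 \<le> card (verts G)"
    by linarith
  then show ?case
  proof cases
    case 1
    then obtain v where "verts G = {v}" by (rule card_1_singletonE)
    \<comment> \<open>An arc on a single vertex would be a loop.\<close>
    then have "arcs G = {}"
      using no_loops tail_in_verts head_in_verts by fastforce
    with 1 show ?thesis by (intro exI[of _ 0]) (simp add: pruning_final_def)
  next
    case 2
    with less.prems show ?thesis
      by (intro exI[of _ 0]) (simp add: pruning_final_def undirected_tree_iff_finite_tree)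
  next
    case 3
    then have "verts (prune G) \<subset> verts G"
      using leaf_exists leaves_subset_verts[of G] by auto
    then have "card (verts (prune G)) < card (verts G)"
      by (rule psubset_card_mono[OF finite_verts])
    then obtain s where "pruning_final (pruned (prune G) s)"
      using less.hyps finite_tree_prune[OF 3] by blast
    then show ?thesis by (auto simp: pruned_prune)
  qed
qed

lemma verts_eq_leaves_if_final:
  assumes "pruning_final H"
  shows "leaves H = verts H"
proof (cases "card (verts H) = 1")
  case True
  then show ?thesis by (auto simp: leaves_def card_1_singleton_iff)
next
  case False
  with assms have card: "card (verts H) = 2" and "finite_tree H"
    by (auto simp: pruning_final_def undirected_tree_iff_finite_tree)
  then interpret finite_tree H by simp
  have "\<exists>w. neighbors H v = {w}" if v: "v \<in> verts H" for v
  proof -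
    \<comment> \<open>In the two-vertex case the neighbourhood is a nonempty subset of a
      singleton.\<close>
    have "neighbors H v \<subseteq> verts H - {v}"
      using neighbors_subset_verts adj_not_same by (auto simp: neighbors_def)
    moreover have "card (verts H - {v}) = 1"
      using v card by simp
    ultimately show ?thesis
      using neighbors_nonempty[OF v] card by (auto simp: card_1_singleton_iff subset_singleton_iff)
  qed
  with card show ?thesis
    using leaf_iff by auto
qed

theorem lemma3p1:
  fixes G :: "('a, 'b) pre_digraph" and R :: "'a rel"
  assumes "undirected_tree G"
    and "equiv (verts G) R"
    and "balanced G R"
    and "\<not> trivial_equiv (verts G) R"
  shows "\<forall>c \<in> verts G. \<exists>i \<le> pruning_length G. R `` {c} \<subseteq> leaves (pruned G i)"
proof
  fix c assume c: "c \<in> verts G"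
  let ?s = "pruning_length G"
  have "pruning_final (pruned G ?s)"
    unfolding pruning_length_def
    by (rule LeastI_ex) (use assms(1) pruning_terminates undirected_tree_iff_finite_tree in blast)
  then have "leaves (pruned G ?s) = verts (pruned G ?s)"
    by (rule verts_eq_leaves_if_final)
  \<comment> \<open>Either \<open>c\<close> became a leaf before step \<open>?s\<close>, or it
    survives to the final graph, all of whose vertices are leaves; the second case is why
    \<open>i = ?s\<close> has to be allowed.\<close>
  then obtain i where i: "i \<le> ?s" "c \<in> leaves (pruned G i)"
    using pruned_verts_or_leaf[OF c, of ?s] less_imp_le by blast
  have "graph G" using assms(1) by (simp add: undirected_tree_def)
  note inv = pruned_invariant[OF this assms(2,3), of i]
  have "R `` {c} \<subseteq> leaves (pruned G i)"
  proof
    fix d assume "d \<in> R `` {c}"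
    then show "d \<in> leaves (pruned G i)"
      using inv i(2) by (auto intro: graph.leaves_related)
  qed
  with i(1) show "\<exists>i \<le> ?s. R `` {c} \<subseteq> leaves (pruned G i)" by blast
qed

end
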